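(* Let $n\ge 1$, let $f_1,\dots,f_n:\mathsf H\to\mathbb R$ be functions on a separable real Hilbert space $\mathsf H$, let $F=\frac1n\sum_{i=1}^n f_i$, and assume $\operatorname{argmin}F\neq\varnothing$. Assume that each $f_i$ is convex and $L$-smooth for some $L>0$, and that $F$ satisfies the Polyak–Łojasiewicz condition with constant $\mu>0$: $F(x)-F_*\le\frac1{2\mu}\|\nabla F(x)\|^2$ for all $x\in\mathsf H$. Let $(\boldsymbol x^k)_{k\in\mathbb N}$ be generated by the L-SVRP algorithm described in the context, with parameter $p\in\,]0,1]$ and step size $\alpha$. Let $M>2/p$ and let $\alpha>0$ be such that $\alpha<\frac1{L(2+pM)}$. Set $$q=\max\Big\{1-\alpha\mu\big(1-\alpha L(2+pM)\big),\;1+\frac2M-p\Big\}.$$ Then $q\in\,]0,1[$ and for all $k\in\mathbb N$, $$\mathsf E[\operatorname{dist}(\boldsymbol x^k,\operatorname{argmin}F)^2]\le q^k\big(\operatorname{dist}(\boldsymbol x^0,\operatorname{argmin}F)^2+\alpha^2M\,\mathsf E[\sigma_0^2]\big),$$ $$\mathsf E[F(\boldsymbol x^k)-F_*]\le\frac{q^kL}2\big(\operatorname{dist}(\boldsymbol x^0,\operatorname{argmin}F)^2+\alpha^2M\,\mathsf E[\sigma_0^2]\big),$$ where $\sigma_0^2=\frac1n\sum_{i=1}^n\|\nabla f_i(\boldsymbol u^0)-\nabla f_i(\boldsymbol y^0)\|^2$ and $\boldsymbol y^0\in\operatorname{argmin}F$ is such that $\|\boldsymbol u^0-\boldsymbol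 y^0\|=\operatorname{dist}(\boldsymbol u^0,\operatorname{argmin}F)$.
   Context: Notation: $F_*=\inf F$; $\operatorname{dist}(x,S)=\inf_{z\in S}\|x-z\|$; $\operatorname{prox}_{\varphi}(x)=\operatorname{argmin}_{y\in\mathsf H}\{\varphi(y)+\frac12\|y-x\|^2\}$. A function $f$ is $L$-smooth if it is differentiable and $\|\nabla f(x)-\nabla f(y)\|\le L\|x-y\|$ for all $x,y\in\mathsf H$. L-SVRP algorithm: $(i_k)_{k\in\mathbb N}$ is a sequence of i.i.d. random variables uniformly distributed on $\{1,\dots,n\}$, and $(\varepsilon^k)_{k\in\mathbb N}$ is a sequence of i.i.d. Bernoulli random variables with $\mathsf P(\varepsilon^k=1)=p\in\,]0,1]$; with $\mathfrak F_k=\sigma(i_0,\dots,i_{k-1},\varepsilon^0,\dots,\varepsilon^{k-1})$, both $i_k$ and $\varepsilon^k$ are independent of $\mathfrak F_k$. Let $\alpha>0$ and let the (deterministic) initial points be $\boldsymbol x^0=\boldsymbol u^0\in\mathsf H$. For $k=0,1,\dots$ $$\boldsymbol x^{k+1}=\operatorname{prox}_{\alpha f_{i_k}}\big(\boldsymbol x^k+\alpha\nabla f_{i_k}(\boldsymbol u^k)-\alpha\nabla F(\boldsymbol u^k)\big),\qquad\boldsymbol u^{k+1}=(1-\varepsilon^k)\boldsymbol u^k+\varepsilon^k\boldsymbol x^k.$$ *)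

theory Defs
  imports "HOL-Probability.Probability"
begin

text \<open>On a Hilbert space, differentiability yields a gradient vector by Riesz representation.\<close>

definition grad :: "('a::real_inner \<Rightarrow> real) \<Rightarrow> 'a \<Rightarrow> 'a" where
  "grad f x = (THE D. GDERIV f x :> D)"

definition L_smooth :: "real \<Rightarrow> ('a::real_inner \<Rightarrow> real) \<Rightarrow> bool" where
  "L_smooth L f \<longleftrightarrow>
     (\<forall>x. f differentiable (at x)) \<and>
     (\<forall>x y. norm (grad f x - grad f y) \<le> L * norm (x - y))"

definition argmin_set :: "('a \<Rightarrow> real) \<Rightarrow> 'a set" where
  "argmin_set f = {x. is_arg_min f (\<lambda>_. True) x}"

definition PL_condition :: "real \<Rightarrow> ('a::real_inner \<Rightarrow> real) \<Rightarrow> bool" where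
  "PL_condition \<mu> f \<longleftrightarrow>
     (\<forall>x. f x - (INF y. f y) \<le> 1 / (2 * \<mu>) * (norm (grad f x))\<^sup>2)"

text \<open>The minimizer is unique for convex continuous \<open>\<phi>\<close> on a Hilbert space; the choice
  built into \<^const>\<open>arg_min\<close> only matters outside that case.\<close>

definition prox :: "('a::real_inner \<Rightarrow> real) \<Rightarrow> 'a \<Rightarrow> 'a" where
  "prox \<phi> x = arg_min (\<lambda>y. \<phi> y + 1 / 2 * (norm (y - x))\<^sup>2) (\<lambda>_. True)"

text \<open>The sigma-algebra generated by a variable with values in a discrete space.\<close>

definition generated_events :: "'w measure \<Rightarrow> ('w \<Rightarrow> 'b) \<Rightarrow> 'w set set" where
  "generated_events P X = {X -` A \<inter> space P | A. True}"

definition lsvrp_history ::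
  "'w measure \<Rightarrow> (nat \<Rightarrow> 'w \<Rightarrow> nat) \<Rightarrow> (nat \<Rightarrow> 'w \<Rightarrow> bool) \<Rightarrow> nat \<Rightarrow> 'w set set" where
  "lsvrp_history P \<iota> \<epsilon> k =
     sigma_sets (space P) (\<Union>j<k. generated_events P (\<iota> j) \<union> generated_events P (\<epsilon> j))"

text \<open>The Bernoulli variables are boolean, with \<^term>\<open>True\<close> standing for the value 1.
  No independence between \<open>\<iota> k\<close> and \<open>\<epsilon> k\<close> at the same step \<open>k\<close> is required.\<close>

definition lsvrp_sampling ::
  "'w measure \<Rightarrow> nat \<Rightarrow> real \<Rightarrow> (nat \<Rightarrow> 'w \<Rightarrow> nat) \<Rightarrow> (nat \<Rightarrow> 'w \<Rightarrow> bool) \<Rightarrow> bool" where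
  "lsvrp_sampling P n p \<iota> \<epsilon> \<longleftrightarrow>
     prob_space.indep_vars P (\<lambda>_. count_space UNIV) \<iota> UNIV \<and>
     (\<forall>k. distr P (count_space UNIV) (\<iota> k) = measure_pmf (pmf_of_set {1..n})) \<and>
     prob_space.indep_vars P (\<lambda>_. count_space UNIV) \<epsilon> UNIV \<and>
     (\<forall>k. distr P (count_space UNIV) (\<epsilon> k) = measure_pmf (bernoulli_pmf p)) \<and>
     (\<forall>k. prob_space.indep_set P (generated_events P (\<iota> k)) (lsvrp_history P \<iota> \<epsilon> k)) \<and>
     (\<forall>k. prob_space.indep_set P (generated_events P (\<epsilon> k)) (lsvrp_history P \<iota> \<epsilon> k))"

definition lsvrp_iterates ::
  "'w measure \<Rightarrow> nat \<Rightarrow> (nat \<Rightarrow> 'a::real_inner \<Rightarrow> real) \<Rightarrow> real \<Rightarrow>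
   (nat \<Rightarrow> 'w \<Rightarrow> nat) \<Rightarrow> (nat \<Rightarrow> 'w \<Rightarrow> bool) \<Rightarrow> 'a \<Rightarrow>
   (nat \<Rightarrow> 'w \<Rightarrow> 'a) \<Rightarrow> (nat \<Rightarrow> 'w \<Rightarrow> 'a) \<Rightarrow> bool" where
  "lsvrp_iterates P n f \<alpha> \<iota> \<epsilon> x0 x u \<longleftrightarrow>
     (let F = (\<lambda>z. 1 / real n * (\<Sum>i=1..n. f i z)) in
      \<forall>\<omega>\<in>space P.
        x 0 \<omega> = x0 \<and> u 0 \<omega> = x0 \<and>
        (\<forall>k. x (Suc k) \<omega> =
               prox (\<lambda>z. \<alpha> * f (\<iota> k \<omega>) z)
                 (x k \<omega> + \<alpha> *\<^sub>R grad (f (\<iota> k \<omega>)) (u k \<omega>) - \<alpha> *\<^sub>R grad F (u k \<omega>)) \<and>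
             u (Suc k) \<omega> =
               (1 - of_bool (\<epsilon> k \<omega>)) *\<^sub>R u k \<omega> + of_bool (\<epsilon> k \<omega>) *\<^sub>R x k \<omega>))"

definition sigma_sq :: "nat \<Rightarrow> (nat \<Rightarrow> 'a::real_inner \<Rightarrow> real) \<Rightarrow> 'a \<Rightarrow> 'a \<Rightarrow> real" where
  "sigma_sq n f u y = 1 / real n * (\<Sum>i=1..n. (norm (grad (f i) u - grad (f i) y))\<^sup>2)"

end

theory Submission
  imports Defs
begin

text \<open>
  Write \<open>w\<^sub>i = \<nabla>f\<^sub>i(x) - \<nabla>f\<^sub>i(u) + \<nabla>F(u)\<close>. By convexity the proximal step with index \<open>i\<close> is no
  worse than the gradient step along \<open>w\<^sub>i\<close>:
  \<open>\<parallel>x\<^sup>+ - y\<parallel>\<^sup>2 \<le> \<parallel>x - y\<parallel>\<^sup>2 - 2\<alpha>(f\<^sub>i(x) - f\<^sub>i(y)) + 2\<alpha>\<langle>\<nabla>f\<^sub>i(u) - \<nabla>F(u), x - y\<rangle> + \<alpha>\<^sup>2\<parallel>w\<^sub>i\<parallel>\<^sup>2\<close>.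
  Averaging over \<open>i\<close> kills the inner product, and cocoercivity of the gradients bounds the mean of
  \<open>\<parallel>w\<^sub>i\<parallel>\<^sup>2\<close> by \<open>4L(F(x) - F\<^sub>*) + 2\<sigma>\<^sup>2\<close>, where \<open>\<sigma>\<^sup>2\<close> itself evolves in mean to at most
  \<open>(1 - p)\<sigma>\<^sup>2 + 2pL(F(x) - F\<^sub>*)\<close>. Since the Polyak-Lojasiewicz condition implies quadratic growth,
  \<open>F(x) - F\<^sub>* \<ge> (\<mu>/2) dist(x, argmin F)\<^sup>2\<close>, the Lyapunov function
  \<open>dist(x, argmin F)\<^sup>2 + \<alpha>\<^sup>2 M \<sigma>\<^sup>2\<close> contracts in expectation by the factor \<open>q\<close> in every step.
\<close>

section \<open>Smooth convex functions on a Hilbert space\<close>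

lemma argmin_set_least: "z \<in> argmin_set F \<Longrightarrow> F z \<le> F v" for F :: "'a \<Rightarrow> real"
  by (simp add: argmin_set_def is_arg_min_linorder)

lemma argmin_set_INF:
  fixes F :: "'a \<Rightarrow> real"
  assumes "z \<in> argmin_set F"
  shows "(INF v. F v) = F z"
  by (rule cInf_eq_minimum) (use assms argmin_set_least in auto)

text \<open>The representing vector is the minimizer of \<open>\<psi>\<close>: this function is
  bounded below, its minimizing sequences are Cauchy by the parallelogram identity, and its
  derivative vanishes at the limit. It turns a Frechet derivative into a gradient vector.\<close>

lemma Riesz_representation:
  fixes T :: "'a::{real_inner, complete_space} \<Rightarrow> real"
  assumes "bounded_linear T"
  shows "\<exists>D. \<forall>h. T h = inner h D"
proof -
  interpret T: bounded_linear T by fact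
  define \<psi> where "\<psi> y = (norm y)\<^sup>2 - 2 * T y" for y
  obtain B where B: "\<bar>T y\<bar> \<le> B * norm y" for y
    using T.nonneg_bounded by (auto simp: mult.commute)
  have below: "- B\<^sup>2 \<le> \<psi> y" for y
  proof -
    have "0 \<le> (norm y - B)\<^sup>2" by simp
    with B[of y] show ?thesis
      unfolding \<psi>_def by (simp add: power2_eq_square algebra_simps)
  qed
  define m where "m = (INF y. \<psi> y)"
  have bdd: "bdd_below (range \<psi>)"
    by (rule bdd_belowI2) (rule below)
  have m_le: "m \<le> \<psi> y" for y
    unfolding m_def using bdd by (simp add: cINF_lower)
  have "\<exists>y. \<psi> y < m + inverse (real (Suc k))" for k
    using cINF_less_iff[OF _ bdd, of "m + inverse (real (Suc k))"] by (auto simp: m_def)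
  then obtain s where s: "\<psi> (s k) < m + inverse (real (Suc k))" for k
    by metis
  \<comment> \<open>The midpoint of \<open>a\<close> and \<open>b\<close> also has value at least
    \<open>m\<close>, which limits how far apart two near-minimizers can lie.\<close>
  have parallelogram: "(dist a b)\<^sup>2 \<le> 2 * (\<psi> a - m) + 2 * (\<psi> b - m)" for a b
  proof -
    have "4 * \<psi> ((1/2) *\<^sub>R (a + b)) = 2 * \<psi> a + 2 * \<psi> b - (dist a b)\<^sup>2"
      unfolding \<psi>_def T.scaleR T.add dist_norm power2_norm_eq_inner
      by (simp add: inner_add inner_diff inner_commute algebra_simps)
    with m_le[of "(1/2) *\<^sub>R (a + b)"] show ?thesis by simp
  qed
  have "Cauchy s"
  proof (rule metric_CauchyI)
    fix e :: real assume "e > 0"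
    then obtain N where N: "inverse (real (Suc N)) < e\<^sup>2 / 4"
      using reals_Archimedean[of "e\<^sup>2 / 4"] by auto
    have *: "\<psi> (s k) - m < e\<^sup>2 / 4" if "k \<ge> N" for k
    proof -
      have "inverse (real (Suc k)) \<le> inverse (real (Suc N))"
        using that by (simp add: field_simps)
      with s[of k] N show ?thesis by linarith
    qed
    show "\<exists>N. \<forall>j\<ge>N. \<forall>k\<ge>N. dist (s j) (s k) < e"
    proof (intro exI allI impI)
      fix j k assume "j \<ge> N" "k \<ge> N"
      then have "(dist (s j) (s k))\<^sup>2 < e\<^sup>2"
        using parallelogram[of "s j" "s k"] *[of j] *[of k] by simp
      then show "dist (s j) (s k) < e"
        using \<open>e > 0\<close> by (simp add: power_less_imp_less_base)
    qed
  qed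
  then obtain z where z: "s \<longlonglongrightarrow> z"
    using Cauchy_convergent convergent_def by blast
  have "(\<lambda>k. \<psi> (s k)) \<longlonglongrightarrow> \<psi> z"
    unfolding \<psi>_def by (intro tendsto_intros T.tendsto z)
  moreover have "(\<lambda>k. m + inverse (real (Suc k))) \<longlonglongrightarrow> m + 0"
    by (intro tendsto_intros LIMSEQ_inverse_real_of_nat)
  ultimately have "\<psi> z \<le> m"
    using LIMSEQ_le[of "\<lambda>k. \<psi> (s k)" "\<psi> z" "\<lambda>k. m + inverse (real (Suc k))" m] s less_imp_le
    by auto
  then have z_min: "\<psi> z \<le> \<psi> y" for y
    using m_le[of y] by linarith
  have "(\<psi> has_derivative (\<lambda>h. 2 * inner z h - 2 * T h)) (at z)"
    unfolding \<psi>_def power2_norm_eq_inner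
    by (auto intro!: derivative_eq_intros T.has_derivative simp: inner_commute)
  then have "(\<lambda>h. 2 * inner z h - 2 * T h) = (\<lambda>h. 0)"
    using z_min by (intro has_derivative_local_min) auto
  then have "T h = inner h z" for h
    by (metis eq_iff_diff_eq_0 inner_commute mult_cancel_left zero_neq_numeral)
  then show ?thesis by blast
qed

text \<open>As \<open>grad\<close> is a definite description, uniqueness must be shown: two
  gradients induce the same linear form, and evaluating it at their difference makes that difference
  zero.\<close>

lemma GDERIV_imp_grad_eq:
  assumes "GDERIV f x :> D"
  shows "grad f x = D"
proof -
  have "E = D" if "GDERIV f x :> E" for E
  proof -
    have "(\<lambda>h. inner h E) = (\<lambda>h. inner h D)"
      using assms that unfolding gderiv_def by (rule has_derivative_unique[rotated])
    then have "inner (E - D) E = inner (E - D) D" by metis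
    then have "inner (E - D) (E - D) = 0" by (simp add: inner_diff_right)
    then show ?thesis by simp
  qed
  with assms show ?thesis unfolding grad_def by blast
qed

lemma GDERIV_grad:
  fixes f :: "'a::{real_inner, complete_space} \<Rightarrow> real"
  assumes "f differentiable (at x)"
  shows "GDERIV f x :> grad f x"
proof -
  obtain T where T: "(f has_derivative T) (at x)"
    using assms unfolding differentiable_def by blast
  then obtain D where "\<forall>h. T h = inner h D"
    using Riesz_representation has_derivative_bounded_linear by blast
  with T have "GDERIV f x :> D"
    unfolding gderiv_def by (simp add: fun_eq_iff[symmetric])
  then show ?thesis by (simp add: GDERIV_imp_grad_eq)
qed

lemma GDERIV_imp_line_derivative:
  assumes "GDERIV f (x + t *\<^sub>R d) :> D"
  shows "((\<lambda>s. f (x + s *\<^sub>R d)) has_real_derivative inner d D) (at t)"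
proof -
  have "((\<lambda>s. x + s *\<^sub>R d) has_derivative (\<lambda>h. h *\<^sub>R d)) (at t)"
    by (auto intro!: derivative_eq_intros)
  from has_derivative_compose[OF this assms[unfolded gderiv_def]]
  show ?thesis by (simp add: has_field_derivative_def mult_commute_abs)
qed

section \<open>Inequalities for smooth and for convex smooth functions\<close>

context
  fixes f :: "'a::{real_inner, complete_space} \<Rightarrow> real" and L :: real
  assumes smooth: "L_smooth L f"
begin

lemma L_smooth_GDERIV: "GDERIV f x :> grad f x"
  using smooth unfolding L_smooth_def by (simp add: GDERIV_grad)

lemma L_smooth_isCont: "isCont f x"
  using L_smooth_GDERIV[of x] has_derivative_continuous unfolding gderiv_def by blast

lemma L_smooth_grad_Lipschitz: "norm (grad f x - grad f y) \<le> L * norm (x - y)"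
  using smooth unfolding L_smooth_def by blast

lemma L_smooth_grad_argmin:
  assumes "y \<in> argmin_set f"
  shows "grad f y = 0"
proof -
  have "(\<lambda>h. inner h (grad f y)) = (\<lambda>h. 0)"
    using L_smooth_GDERIV[of y] argmin_set_least[OF assms]
    unfolding gderiv_def by (intro has_derivative_local_min) auto
  then show ?thesis by (metis inner_eq_zero_iff)
qed

text \<open>The descent lemma. Up to a constant, \<open>g\<close> is the difference of the two sides
  along the segment; Cauchy-Schwarz and the Lipschitz bound make its derivative nonpositive, so
  monotonicity replaces integration.\<close>

lemma L_smooth_descent: "f (x + d) \<le> f x + inner d (grad f x) + L / 2 * (norm d)\<^sup>2"
proof -
  define g where "g t = f (x + t *\<^sub>R d) - t * inner d (grad f x) - L / 2 * t\<^sup>2 * (norm d)\<^sup>2" for t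
  have "g 1 \<le> g 0"
  proof (rule DERIV_nonpos_imp_nonincreasing[of 0 1])
    fix t :: real assume "0 \<le> t" "t \<le> 1"
    let ?D = "inner d (grad f (x + t *\<^sub>R d)) - inner d (grad f x) - L * t * (norm d)\<^sup>2"
    have "DERIV g t :> ?D"
      unfolding g_def
      by (auto intro!: derivative_eq_intros GDERIV_imp_line_derivative L_smooth_GDERIV)
    moreover have "?D \<le> 0"
    proof -
      have "inner d (grad f (x + t *\<^sub>R d) - grad f x)
          \<le> norm d * norm (grad f (x + t *\<^sub>R d) - grad f x)"
        by (rule norm_cauchy_schwarz)
      also have "\<dots> \<le> norm d * (L * norm (x + t *\<^sub>R d - x))"
        by (intro mult_left_mono L_smooth_grad_Lipschitz) simp
      also have "\<dots> = L * t * (norm d)\<^sup>2"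
        using \<open>0 \<le> t\<close> by (simp add: power2_eq_square)
      finally show ?thesis by (simp add: inner_diff_right)
    qed
    ultimately show "\<exists>D. DERIV g t :> D \<and> D \<le> 0" by blast
  qed simp
  then show ?thesis by (simp add: g_def)
qed

lemma L_smooth_gradient_step:
  "f (x - t *\<^sub>R grad f x) \<le> f x - t * (1 - L * t / 2) * (norm (grad f x))\<^sup>2"
  using L_smooth_descent[of x "- t *\<^sub>R grad f x"]
  by (simp add: power_mult_distrib algebra_simps power2_eq_square flip: power2_norm_eq_inner)

text \<open>Restriction to the line through \<open>x\<close> and \<open>y\<close> reduces this to
  the one-dimensional tangent inequality, with tangent point 0 and evaluation point 1.\<close>

lemma convex_above_tangent:
  assumes "convex_on UNIV f"
  shows "f x + inner (y - x) (grad f x) \<le> f y"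
proof -
  let ?g = "\<lambda>t. f (x + t *\<^sub>R (y - x))"
  have "convex_on UNIV ?g"
  proof (rule convex_onI)
    fix t a b :: real assume t: "0 < t" "t < 1"
    have eq: "x + ((1 - t) *\<^sub>R a + t *\<^sub>R b) *\<^sub>R (y - x)
        = (1 - t) *\<^sub>R (x + a *\<^sub>R (y - x)) + t *\<^sub>R (x + b *\<^sub>R (y - x))"
      by (simp add: algebra_simps)
    show "?g ((1 - t) *\<^sub>R a + t *\<^sub>R b) \<le> (1 - t) * ?g a + t * ?g b"
      unfolding eq by (rule convex_onD[OF assms]) (use t in auto)
  qed simp
  moreover have "(?g has_real_derivative inner (y - x) (grad f x)) (at 0)"
    using GDERIV_imp_line_derivative[of f x 0 "y - x"] L_smooth_GDERIV by simp
  ultimately show ?thesis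
    using convex_on_imp_above_tangent[of UNIV ?g 0 1 "inner (y - x) (grad f x)"] by simp
qed

text \<open>A form of cocoercivity. At any point \<open>z\<close> the tangent at \<open>y\<close>
  lies below the descent bound at \<open>x\<close>; the best choice of \<open>z\<close> gives the
  claim.\<close>

lemma convex_grad_diff_le_Bregman:
  assumes "convex_on UNIV f" and "L > 0"
  shows "(norm (grad f x - grad f y))\<^sup>2 \<le> 2 * L * (f x - f y - inner (x - y) (grad f y))"
proof -
  define d where "d = grad f x - grad f y"
  \<comment> \<open>This point minimizes the descent bound at \<open>x\<close> minus the tangent at
    \<open>y\<close>.\<close>
  define z where "z = x + (- (1 / L)) *\<^sub>R d"
  have "f y + inner (z - y) (grad f y) \<le> f x + inner (z - x) (grad f x) + L / 2 * (norm (z - x))\<^sup>2"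
    using convex_above_tangent[OF assms(1), of y z] L_smooth_descent[of x "z - x"] by simp
  moreover have "inner (z - y) (grad f y) = inner (x - y) (grad f y) - 1 / L * inner d (grad f y)"
    by (simp add: z_def inner_diff_left inner_add_left)
  moreover have "inner (z - x) (grad f x) = - (1 / L) * inner d (grad f x)"
    by (simp add: z_def)
  moreover have "L / 2 * (norm (z - x))\<^sup>2 = L / 2 * ((norm d)\<^sup>2 / L\<^sup>2)"
    by (simp add: z_def power_divide)
  moreover have "1 / L * inner d (grad f x) - 1 / L * inner d (grad f y) = (norm d)\<^sup>2 / L"
    by (simp add: d_def power2_norm_eq_inner inner_diff_right flip: diff_divide_distrib)
  ultimately have "(norm d)\<^sup>2 / L - L / 2 * ((norm d)\<^sup>2 / L\<^sup>2) \<le> f x - f y - inner (x - y) (grad f y)"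
    by linarith
  moreover have "(norm d)\<^sup>2 / L - L / 2 * ((norm d)\<^sup>2 / L\<^sup>2) = (norm d)\<^sup>2 / (2 * L)"
    using \<open>L > 0\<close> by (simp add: field_simps power2_eq_square)
  ultimately have "(norm d)\<^sup>2 / (2 * L) \<le> f x - f y - inner (x - y) (grad f y)"
    by simp
  then show ?thesis
    using \<open>L > 0\<close> unfolding d_def by (simp add: pos_divide_le_eq mult.commute)
qed

text \<open>The implicit form of a proximal step. Since \<open>\<alpha> * L < 1\<close>, Banach's
  theorem solves the optimality equation; by convexity the solution is the only minimizer, hence the
  one that the choice operator in \<open>prox\<close> returns.\<close>

lemma prox_fixed_point:
  assumes "convex_on UNIV f" and "0 < \<alpha>" and "\<alpha> * L < 1" and "0 \<le> L"
  shows "prox (\<lambda>z. \<alpha> * f z) v + \<alpha> *\<^sub>R grad f (prox (\<lambda>z. \<alpha> * f z) v) = v"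
proof -
  let ?G = "\<lambda>z. v - \<alpha> *\<^sub>R grad f z"
  have "\<exists>!z. ?G z = z"
  proof (rule banach_fix_type)
    show "\<forall>a b. dist (?G a) (?G b) \<le> (\<alpha> * L) * dist a b"
    proof (intro allI)
      fix a b
      have "dist (?G a) (?G b) = \<alpha> * norm (grad f a - grad f b)"
        using \<open>0 < \<alpha>\<close>
        by (simp add: dist_norm norm_minus_commute flip: scaleR_diff_right)
      also have "\<dots> \<le> \<alpha> * (L * norm (a - b))"
        using \<open>0 < \<alpha>\<close> by (intro mult_left_mono L_smooth_grad_Lipschitz) simp
      finally show "dist (?G a) (?G b) \<le> (\<alpha> * L) * dist a b" by (simp add: dist_norm)
    qed
  qed (use assms in auto)
  then obtain z where z: "\<alpha> *\<^sub>R grad f z = v - z"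
    by (metis add_diff_cancel_left' diff_add_cancel)
  let ?\<phi> = "\<lambda>y. \<alpha> * f y + 1 / 2 * (norm (y - v))\<^sup>2"
  \<comment> \<open>Strong convexity of \<open>?\<phi>\<close> at its critical point: the tangent
    inequality for \<open>f\<close> plus the exact expansion of the square. It gives both minimality
    and uniqueness of \<open>z\<close>.\<close>
  have strong: "?\<phi> z + 1 / 2 * (norm (y - z))\<^sup>2 \<le> ?\<phi> y" for y
  proof -
    have "\<alpha> * (f z + inner (y - z) (grad f z)) \<le> \<alpha> * f y"
      using convex_above_tangent[OF assms(1)] \<open>0 < \<alpha>\<close> by simp
    moreover have "\<alpha> * inner (y - z) (grad f z) = inner (y - z) (v - z)"
      by (metis z inner_scaleR_right)
    moreover have "(norm (z - v))\<^sup>2 + (norm (y - z))\<^sup>2 = (norm (y - v))\<^sup>2 + 2 * inner (y - z) (v - z)"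
      by (simp add: power2_norm_eq_inner inner_diff inner_commute algebra_simps)
    ultimately show ?thesis by (simp add: algebra_simps)
  qed
  have "is_arg_min ?\<phi> (\<lambda>_. True) (prox (\<lambda>z. \<alpha> * f z) v)"
    unfolding prox_def arg_min_def
  proof (rule someI)
    show "is_arg_min ?\<phi> (\<lambda>_. True) z"
      unfolding is_arg_min_linorder
    proof (intro conjI allI impI TrueI)
      fix y
      show "?\<phi> z \<le> ?\<phi> y"
        using strong[of y] zero_le_power2[of "norm (y - z)"] by linarith
    qed
  qed
  then have "?\<phi> (prox (\<lambda>z. \<alpha> * f z) v) \<le> ?\<phi> z"
    by (simp add: is_arg_min_linorder)
  with strong[of "prox (\<lambda>z. \<alpha> * f z) v"] have "(norm (prox (\<lambda>z. \<alpha> * f z) v - z))\<^sup>2 \<le> 0"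
    by linarith
  then have "prox (\<lambda>z. \<alpha> * f z) v = z" by simp
  with z show ?thesis by simp
qed

text \<open>Convexity is used twice, from \<open>x\<close> to \<open>x'\<close> and from
  \<open>x'\<close> to \<open>y\<close>. This trades the implicit gradient at \<open>x'\<close> for
  the explicit one at \<open>x\<close>; \<open>e\<close> stands for the variance-reducing
  correction.\<close>

lemma prox_step_estimate:
  fixes x e y :: 'a
  assumes "convex_on UNIV f" and "0 < \<alpha>" and "\<alpha> * L < 1" and "0 \<le> L"
  defines "x' \<equiv> prox (\<lambda>z. \<alpha> * f z) (x + \<alpha> *\<^sub>R e)"
  shows "(norm (x' - y))\<^sup>2 \<le> (norm (x - y))\<^sup>2 + 2 * \<alpha> * (f y - f x) + 2 * \<alpha> * inner (x - y) e
           + \<alpha>\<^sup>2 * (norm (grad f x - e))\<^sup>2"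
proof -
  define d where "d = x' - x"
  have d: "d = \<alpha> *\<^sub>R e - \<alpha> *\<^sub>R grad f x'"
    using prox_fixed_point[OF assms(1-4), of "x + \<alpha> *\<^sub>R e"]
    unfolding d_def x'_def by (simp add: algebra_simps)
  have "f x + inner d (grad f x) \<le> f x'"
    using convex_above_tangent[OF assms(1), of x x'] by (simp add: d_def)
  moreover have "f x' + inner (y - x') (grad f x') \<le> f y"
    by (rule convex_above_tangent[OF assms(1)])
  ultimately have "f x + inner d (grad f x) + inner (y - x') (grad f x') \<le> f y"
    by linarith
  then have "2 * \<alpha> * (f x + inner d (grad f x) + inner (y - x') (grad f x')) \<le> 2 * \<alpha> * f y"
    using \<open>0 < \<alpha>\<close> by simp
  then have "2 * \<alpha> * f x + 2 * \<alpha> * inner d (grad f x) + 2 * (\<alpha> * inner (y - x') (grad f x'))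
      \<le> 2 * \<alpha> * f y"
    by (simp add: distrib_left mult.assoc)
  moreover have "\<alpha> * inner (y - x') (grad f x') = inner (y - x') (\<alpha> *\<^sub>R e - d)"
    unfolding d by simp
  moreover have x': "x' = x + d" by (simp add: d_def)
  moreover have "inner (y - x') (\<alpha> *\<^sub>R e - d)
     = - \<alpha> * inner (x - y) e - \<alpha> * inner d e + inner d (x - y) + (norm d)\<^sup>2"
    unfolding x' by (simp add: power2_norm_eq_inner inner_diff inner_add inner_commute algebra_simps)
  \<comment> \<open>Discarding this square eliminates \<open>d\<close> and leaves the squared length
    of the explicit step.\<close>
  moreover have "0 \<le> (norm (d + \<alpha> *\<^sub>R (grad f x - e)))\<^sup>2" by simp
  moreover have "(norm (d + \<alpha> *\<^sub>R (grad f x - e)))\<^sup>2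
      = (norm d)\<^sup>2 + 2 * \<alpha> * (inner d (grad f x) - inner d e) + \<alpha>\<^sup>2 * (norm (grad f x - e))\<^sup>2"
    using dot_norm[of d "\<alpha> *\<^sub>R (grad f x - e)"] by (simp add: power_mult_distrib inner_diff_right)
  moreover have "(norm (x' - y))\<^sup>2 = (norm (x - y))\<^sup>2 + 2 * inner d (x - y) + (norm d)\<^sup>2"
    unfolding x' using dot_norm[of d "x - y"] by (simp add: algebra_simps)
  ultimately show ?thesis
    unfolding right_diff_distrib mult.assoc by linarith
qed

end

text \<open>Taking square roots lets the bound pass to the infimum over \<open>S\<close>. The case
  \<open>a < C\<close> is included because \<open>sqrt\<close> of a negative number is
  negative.\<close>

lemma le_infdist_sq_plusI:
  assumes "S \<noteq> {}" and "\<And>y. y \<in> S \<Longrightarrow> a \<le> (dist x y)\<^sup>2 + C"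
  shows "a \<le> (infdist x S)\<^sup>2 + C"
proof -
  have "sqrt (a - C) \<le> infdist x S"
    unfolding infdist_notempty[OF assms(1)]
    using assms by (intro cINF_greatest real_le_lsqrt) (auto simp: algebra_simps)
  then show ?thesis
    using sqrt_le_D by fastforce
qed

text \<open>The descent lemma started at a minimizer, where the gradient vanishes. It turns the rate
  for the distance into the rate for the function values.\<close>

lemma L_smooth_gap_le_infdist:
  fixes F :: "'a::{real_inner, complete_space} \<Rightarrow> real"
  assumes "L_smooth L F" and "L > 0" and "z \<in> argmin_set F"
  shows "F x - F z \<le> L / 2 * (infdist x (argmin_set F))\<^sup>2"
proof -
  have "2 / L * (F x - F z) \<le> (infdist x (argmin_set F))\<^sup>2 + 0"
  proof (rule le_infdist_sq_plusI)
    fix y assume y: "y \<in> argmin_set F"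
    have "F x \<le> F y + L / 2 * (norm (x - y))\<^sup>2"
      using L_smooth_descent[OF assms(1), of y "x - y"] L_smooth_grad_argmin[OF assms(1) y] by simp
    with argmin_set_least[OF y, of z] have "F x - F z \<le> L / 2 * (norm (x - y))\<^sup>2" by linarith
    then have "2 / L * (F x - F z) \<le> 2 / L * (L / 2 * (norm (x - y))\<^sup>2)"
      using \<open>L > 0\<close> by (intro mult_left_mono) auto
    then show "2 / L * (F x - F z) \<le> (dist x y)\<^sup>2 + 0"
      using \<open>L > 0\<close> by (simp add: dist_norm)
  qed (use assms in auto)
  with \<open>L > 0\<close> show ?thesis by (simp add: field_simps)
qed

section \<open>Quadratic growth under the Polyak-Lojasiewicz condition\<close>

text \<open>Along gradient descent the square root of the optimality gap decreases by at least a multiple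
  of the distance travelled; this multiple tends to the sharp constant as the step size vanishes.\<close>

lemma PL_imp_quadratic_growth:
  fixes F :: "'a::{real_inner, complete_space} \<Rightarrow> real"
  assumes smooth: "L_smooth L F" and "L > 0" and "\<mu> > 0" and PL: "PL_condition \<mu> F"
    and z: "z \<in> argmin_set F"
  shows "\<mu> / 2 * (infdist x (argmin_set F))\<^sup>2 \<le> F x - F z"
proof -
  define s where "s = sqrt (\<mu> / 2)"
  have s: "s > 0" "s\<^sup>2 = \<mu> / 2"
    using \<open>\<mu> > 0\<close> by (auto simp: s_def)
  define g where "g v = F v - F z" for v
  have g_nonneg: "g v \<ge> 0" for v
    using argmin_set_least[OF z] by (simp add: g_def)
  have grad_ge: "2 * \<mu> * g v \<le> (norm (grad F v))\<^sup>2" for v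
  proof -
    have "g v \<le> 1 / (2 * \<mu>) * (norm (grad F v))\<^sup>2"
      using PL unfolding PL_condition_def g_def argmin_set_INF[OF z] by blast
    with \<open>\<mu> > 0\<close> show ?thesis by (simp add: field_simps)
  qed
  \<comment> \<open>Below \<open>\<delta>\<close> the factor \<open>\<kappa>\<close> of the gradient
    step lies in \<open>]0,1]\<close> and the contraction factor \<open>r\<close> in
    \<open>[0,1[\<close>.\<close>
  define \<delta> where "\<delta> = min (1 / L) (1 / (2 * \<mu>))"
  have "\<delta> > 0"
    using assms by (simp add: \<delta>_def)
  have short_step: "(1 - L * t / 2) * (s * infdist x (argmin_set F)) \<le> sqrt (g x)"
    if t: "0 < t" "t < \<delta>" for t
  proof -
    define \<kappa> where "\<kappa> = 1 - L * t / 2"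
    have "L * t < 1" "2 * \<mu> * t < 1"
      using t \<open>L > 0\<close> \<open>\<mu> > 0\<close> by (auto simp: \<delta>_def field_simps)
    then have \<kappa>: "0 < \<kappa>" "\<kappa> \<le> 1"
      using t \<open>L > 0\<close> by (auto simp: \<kappa>_def)
    define T where "T v = v - t *\<^sub>R grad F v" for v
    define r where "r = 1 - 2 * \<mu> * t * \<kappa>"
    have "2 * \<mu> * t * \<kappa> \<le> 2 * \<mu> * t * 1"
      using \<kappa> t \<open>\<mu> > 0\<close> by (intro mult_left_mono) auto
    with \<open>2 * \<mu> * t < 1\<close> have "2 * \<mu> * t * \<kappa> \<le> 1" by linarith
    then have r: "0 \<le> r" "r < 1"
      using \<kappa> t \<open>\<mu> > 0\<close> by (auto simp: r_def)
    have decrease: "g (T v) \<le> g v - t * \<kappa> * (norm (grad F v))\<^sup>2" for v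
      using L_smooth_gradient_step[OF smooth, of v t] by (simp add: g_def T_def \<kappa>_def)
    have contract: "g (T v) \<le> r * g v" for v
    proof -
      have "t * \<kappa> * (2 * \<mu> * g v) \<le> t * \<kappa> * (norm (grad F v))\<^sup>2"
        using grad_ge t \<kappa> by (intro mult_left_mono) auto
      with decrease[of v] show ?thesis by (simp add: r_def algebra_simps)
    qed
    \<comment> \<open>In terms of \<open>a\<close> and \<open>b\<close> the decrease reads
      \<open>t * \<kappa> * N\<^sup>2 \<le> (a + b) * (a - b)\<close>, where
      \<open>a + b \<le> 2 * a\<close>. The Polyak-Lojasiewicz condition in the form
      \<open>2 * s * a \<le> N\<close> then cancels one factor \<open>N\<close>. As this divides by
      \<open>a\<close>, the case \<open>a = 0\<close>, which forces \<open>N = 0\<close>, is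
      separate.\<close>
    have travel: "\<kappa> * s * dist v (T v) \<le> sqrt (g v) - sqrt (g (T v))" for v
    proof -
      define a b N where "a = sqrt (g v)" and "b = sqrt (g (T v))" and "N = norm (grad F v)"
      have ab: "0 \<le> a" "0 \<le> b" "0 \<le> N" "a\<^sup>2 = g v" "b\<^sup>2 = g (T v)"
        using g_nonneg by (auto simp: a_def b_def N_def)
      have dec: "t * \<kappa> * N\<^sup>2 \<le> a\<^sup>2 - b\<^sup>2"
        using decrease[of v] ab by (simp add: N_def)
      have "(2 * s * a)\<^sup>2 = 2 * \<mu> * g v"
        unfolding power_mult_distrib s(2) ab(4) by simp
      then have "(2 * s * a)\<^sup>2 \<le> N\<^sup>2"
        using grad_ge[of v] by (simp only: N_def)
      then have N_ge: "2 * s * a \<le> N"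
        by (rule power2_le_imp_le) (rule ab)
      have "0 \<le> t * \<kappa> * N\<^sup>2"
        using t \<kappa> by simp
      with dec have "b\<^sup>2 \<le> a\<^sup>2" by linarith
      then have "b \<le> a"
        by (rule power2_le_imp_le) (rule ab)
      have "t * \<kappa> * s * N \<le> a - b"
      proof (cases "a = 0")
        case True
        with \<open>b \<le> a\<close> ab have "b = 0" by simp
        with True dec have "t * \<kappa> * N\<^sup>2 \<le> 0" by simp
        with t \<kappa> have "N = 0" by (simp add: mult_le_0_iff)
        with True \<open>b = 0\<close> show ?thesis by simp
      next
        case False
        have "2 * a * (t * \<kappa> * s * N) = t * \<kappa> * N * (2 * s * a)" by simp
        also have "\<dots> \<le> t * \<kappa> * N * N"
          using N_ge t \<kappa> ab by (intro mult_left_mono) auto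
        also have "\<dots> \<le> (a + b) * (a - b)"
          using dec by (simp add: power2_eq_square algebra_simps)
        also have "\<dots> \<le> 2 * a * (a - b)"
          using \<open>b \<le> a\<close> by (intro mult_right_mono) auto
        finally show ?thesis using False ab by simp
      qed
      moreover have "dist v (T v) = t * N"
        using t by (simp add: dist_norm T_def N_def)
      ultimately show ?thesis by (simp add: a_def b_def ac_simps)
    qed
    define w where "w k = (T ^^ k) x" for k
    have w_Suc: "w (Suc k) = T (w k)" and w_0: "w 0 = x" for k
      by (simp_all add: w_def)
    \<comment> \<open>Telescoping \<open>travel\<close>: the remaining path is controlled by the
      root of the current gap, which makes the iterates Cauchy.\<close>
    have length: "\<kappa> * s * dist (w i) (w (i + j)) \<le> sqrt (g (w i)) - sqrt (g (w (i + j)))" for i j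
    proof (induction j)
      case (Suc j)
      have "\<kappa> * s * dist (w i) (w (i + Suc j))
          \<le> \<kappa> * s * (dist (w i) (w (i + j)) + dist (w (i + j)) (w (i + Suc j)))"
        using \<kappa> s by (intro mult_left_mono dist_triangle) auto
      with Suc travel[of "w (i + j)"] show ?case
        by (simp add: w_Suc distrib_left)
    qed simp
    have geometric: "g (w k) \<le> r ^ k * g x" for k
    proof (induction k)
      case (Suc k)
      have "g (w (Suc k)) \<le> r * (r ^ k * g x)"
        using contract[of "w k"] mult_left_mono[OF Suc r(1)] by (simp add: w_Suc)
      then show ?case by simp
    qed (simp add: w_0)
    have "(\<lambda>k. r ^ k * g x) \<longlonglongrightarrow> 0"
      by (rule tendsto_mult_left_zero[OF LIMSEQ_realpow_zero[OF r]])
    then have gap_lim: "(\<lambda>k. g (w k)) \<longlonglongrightarrow> 0"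
      by (rule tendsto_sandwich[OF _ _ tendsto_const, rotated 2])
        (rule always_eventually, rule allI, rule g_nonneg geometric)+
    from tendsto_real_sqrt[OF this] have sqrt_lim: "(\<lambda>k. sqrt (g (w k))) \<longlonglongrightarrow> 0"
      by simp
    have "Cauchy w"
      unfolding Cauchy_altdef
    proof (intro allI impI)
      fix e :: real assume "e > 0"
      with \<kappa> s have "\<kappa> * s * e > 0" by simp
      then have "eventually (\<lambda>k. sqrt (g (w k)) < \<kappa> * s * e) sequentially"
        by (rule order_tendstoD[OF sqrt_lim])
      then obtain K where K: "\<And>k. k \<ge> K \<Longrightarrow> sqrt (g (w k)) < \<kappa> * s * e"
        by (auto simp: eventually_sequentially)
      show "\<exists>K. \<forall>i\<ge>K. \<forall>j>i. dist (w i) (w j) < e"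
      proof (intro exI allI impI)
        fix i j assume "i \<ge> K" "j > i"
        have "\<kappa> * s * dist (w i) (w j) \<le> sqrt (g (w i)) - sqrt (g (w j))"
          using length[of i "j - i"] \<open>j > i\<close> by simp
        also have "\<dots> \<le> sqrt (g (w i))"
          using g_nonneg by simp
        also have "\<dots> < \<kappa> * s * e"
          using K \<open>i \<ge> K\<close> by simp
        finally show "dist (w i) (w j) < e"
          using \<kappa> s by simp
      qed
    qed
    then obtain y where y: "w \<longlonglongrightarrow> y"
      using Cauchy_convergent convergent_def by blast
    \<comment> \<open>By continuity the limit has zero gap, so it is a minimizer and its distance
      from \<open>x\<close> bounds \<open>infdist\<close> from above.\<close>
    have "(\<lambda>k. g (w k)) \<longlonglongrightarrow> g y"
      unfolding g_def
      by (intro tendsto_intros isCont_tendsto_compose[OF L_smooth_isCont[OF smooth] y])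
    from LIMSEQ_unique[OF this gap_lim] have "F y = F z"
      by (simp add: g_def)
    then have "y \<in> argmin_set F"
      using argmin_set_least[OF z] by (simp add: argmin_set_def is_arg_min_linorder)
    have "\<kappa> * s * dist x (w k) \<le> sqrt (g x)" for k
    proof -
      have "\<kappa> * s * dist x (w k) \<le> sqrt (g x) - sqrt (g (w k))"
        using length[of 0 k] by (simp add: w_0)
      also have "\<dots> \<le> sqrt (g x)"
        using g_nonneg by simp
      finally show ?thesis .
    qed
    moreover have "(\<lambda>k. \<kappa> * s * dist x (w k)) \<longlonglongrightarrow> \<kappa> * s * dist x y"
      by (intro tendsto_intros y)
    ultimately have "\<kappa> * s * dist x y \<le> sqrt (g x)"
      using LIMSEQ_le_const2 by blast
    moreover have "\<kappa> * s * infdist x (argmin_set F) \<le> \<kappa> * s * dist x y"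
      using \<kappa> s \<open>y \<in> argmin_set F\<close> by (intro mult_left_mono infdist_le) auto
    ultimately show ?thesis by (simp add: \<kappa>_def)
  qed
  have "s * infdist x (argmin_set F) \<le> sqrt (g x)"
  proof (rule tendsto_upperbound)
    have "((\<lambda>t. (1 - L * t / 2) * (s * infdist x (argmin_set F)))
        \<longlongrightarrow> (1 - L * 0 / 2) * (s * infdist x (argmin_set F))) (at_right 0)"
      by (intro tendsto_intros) auto
    then show "((\<lambda>t. (1 - L * t / 2) * (s * infdist x (argmin_set F)))
        \<longlongrightarrow> s * infdist x (argmin_set F)) (at_right 0)" by simp
    show "eventually (\<lambda>t. (1 - L * t / 2) * (s * infdist x (argmin_set F)) \<le> sqrt (g x)) (at_right 0)"
      using short_step eventually_at_right_real[OF \<open>\<delta> > 0\<close>] by (auto elim: eventually_mono)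
  qed simp
  then have "(s * infdist x (argmin_set F))\<^sup>2 \<le> (sqrt (g x))\<^sup>2"
    using s(1) by (intro power_mono mult_nonneg_nonneg infdist_nonneg) auto
  then show ?thesis
    using s g_nonneg[of x] by (simp add: power_mult_distrib g_def)
qed

section \<open>Averages of smooth convex functions\<close>

text \<open>The parallelogram identity separates \<open>a\<close> from the centered
  \<open>b\<close>, and centering at the mean does not increase the sum of squares.\<close>

lemma sum_norm_sq_centered_le:
  fixes a b :: "nat \<Rightarrow> 'a::real_inner"
  assumes "finite I" and "I \<noteq> {}"
  defines "m \<equiv> (1 / real (card I)) *\<^sub>R (\<Sum>i\<in>I. b i)"
  shows "(\<Sum>i\<in>I. (norm (a i - (b i - m)))\<^sup>2) \<le> 2 * (\<Sum>i\<in>I. (norm (a i))\<^sup>2) + 2 * (\<Sum>i\<in>I. (norm (b i))\<^sup>2)"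
proof -
  have card: "real (card I) > 0"
    using assms by (simp add: card_gt_0_iff)
  then have sum_b: "(\<Sum>i\<in>I. b i) = real (card I) *\<^sub>R m"
    by (simp add: m_def)
  have "(\<Sum>i\<in>I. (norm (b i - m))\<^sup>2) = (\<Sum>i\<in>I. (norm (b i))\<^sup>2 - 2 * inner (b i) m + (norm m)\<^sup>2)"
    by (intro sum.cong refl) (simp add: power2_norm_eq_inner inner_diff inner_commute)
  also have "\<dots> = (\<Sum>i\<in>I. (norm (b i))\<^sup>2) - 2 * inner (\<Sum>i\<in>I. b i) m + real (card I) * (norm m)\<^sup>2"
    by (simp add: sum.distrib sum_subtractf inner_sum_left sum_distrib_left)
  also have "\<dots> = (\<Sum>i\<in>I. (norm (b i))\<^sup>2) - real (card I) * (norm m)\<^sup>2"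
    unfolding sum_b by (simp add: power2_norm_eq_inner)
  also have "\<dots> \<le> (\<Sum>i\<in>I. (norm (b i))\<^sup>2)" by simp
  finally have variance: "(\<Sum>i\<in>I. (norm (b i - m))\<^sup>2) \<le> (\<Sum>i\<in>I. (norm (b i))\<^sup>2)" .
  have "(norm (v - w))\<^sup>2 \<le> 2 * (norm v)\<^sup>2 + 2 * (norm w)\<^sup>2" for v w :: 'a
  proof -
    have "(norm (v - w))\<^sup>2 + (norm (v + w))\<^sup>2 = 2 * (norm v)\<^sup>2 + 2 * (norm w)\<^sup>2"
      by (simp add: power2_norm_eq_inner inner_diff inner_add inner_commute)
    then show ?thesis using zero_le_power2[of "norm (v + w)"] by linarith
  qed
  then have "(\<Sum>i\<in>I. (norm (a i - (b i - m)))\<^sup>2)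
      \<le> (\<Sum>i\<in>I. 2 * (norm (a i))\<^sup>2 + 2 * (norm (b i - m))\<^sup>2)"
    by (intro sum_mono)
  also have "\<dots> = 2 * (\<Sum>i\<in>I. (norm (a i))\<^sup>2) + 2 * (\<Sum>i\<in>I. (norm (b i - m))\<^sup>2)"
    by (simp add: sum.distrib sum_distrib_left)
  finally show ?thesis using variance by linarith
qed

lemma sigma_sq_nonneg: "0 \<le> sigma_sq n f u y"
  unfolding sigma_sq_def by (intro mult_nonneg_nonneg sum_nonneg) auto

locale convex_smooth_average =
  fixes f :: "nat \<Rightarrow> 'a::{real_inner, complete_space} \<Rightarrow> real"
    and n :: nat and L :: real and F :: "'a \<Rightarrow> real" and y0 :: 'a
  assumes n_pos: "n \<ge> 1" and L_pos: "L > 0"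
    and convex: "i \<in> {1..n} \<Longrightarrow> convex_on UNIV (f i)"
    and smooth: "i \<in> {1..n} \<Longrightarrow> L_smooth L (f i)"
    and F_eq: "F = (\<lambda>z. 1 / real n * (\<Sum>i=1..n. f i z))"
    and y0: "y0 \<in> argmin_set F"
begin

lemma sum_f: "(\<Sum>i=1..n. f i z) = real n * F z"
  using n_pos by (simp add: F_eq)

lemma GDERIV_F: "GDERIV F z :> (1 / real n) *\<^sub>R (\<Sum>i=1..n. grad (f i) z)"
proof -
  have "(F has_derivative (\<lambda>h. 1 / real n * (\<Sum>i=1..n. inner h (grad (f i) z)))) (at z)"
    unfolding F_eq
    by (intro has_derivative_mult_right has_derivative_sum
        L_smooth_GDERIV[OF smooth, unfolded gderiv_def])
  then show ?thesis by (simp add: gderiv_def inner_sum_right)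
qed

lemma grad_F: "grad F z = (1 / real n) *\<^sub>R (\<Sum>i=1..n. grad (f i) z)"
  by (rule GDERIV_imp_grad_eq[OF GDERIV_F])

lemma L_smooth_F: "L_smooth L F"
  unfolding L_smooth_def
proof (intro conjI allI)
  fix a b
  show "F differentiable (at a)"
    using GDERIV_F[of a] unfolding gderiv_def differentiable_def by blast
  have "norm (\<Sum>i=1..n. grad (f i) a - grad (f i) b) \<le> (\<Sum>i=1..n. L * norm (a - b))"
    by (rule sum_norm_le) (rule L_smooth_grad_Lipschitz[OF smooth])
  then show "norm (grad F a - grad F b) \<le> L * norm (a - b)"
    using n_pos
    by (simp add: grad_F sum_subtractf flip: scaleR_diff_right) (simp add: field_simps)
qed

lemma grad_F_argmin: "grad F y0 = 0"
  by (rule L_smooth_grad_argmin[OF L_smooth_F y0])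

text \<open>Cocoercivity is averaged with base point \<open>y0\<close>; the inner products cancel
  because the gradients at \<open>y0\<close> sum to zero.\<close>

lemma sigma_sq_le_gap: "sigma_sq n f x y0 \<le> 2 * L * (F x - F y0)"
proof -
  have "(\<Sum>i=1..n. (norm (grad (f i) x - grad (f i) y0))\<^sup>2)
      \<le> (\<Sum>i=1..n. 2 * L * (f i x - f i y0 - inner (x - y0) (grad (f i) y0)))"
    by (intro sum_mono convex_grad_diff_le_Bregman smooth convex L_pos)
  also have "\<dots> = 2 * L * ((\<Sum>i=1..n. f i x) - (\<Sum>i=1..n. f i y0)
      - inner (x - y0) (\<Sum>i=1..n. grad (f i) y0))"
    by (simp add: sum_subtractf inner_sum_right flip: sum_distrib_left)
  also have "(\<Sum>i=1..n. grad (f i) y0) = 0"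
    using grad_F_argmin n_pos by (simp add: grad_F)
  finally have "(\<Sum>i=1..n. (norm (grad (f i) x - grad (f i) y0))\<^sup>2)
      \<le> real n * (2 * L * (F x - F y0))"
    unfolding sum_f by (simp add: algebra_simps)
  then show ?thesis
    using n_pos by (simp add: sigma_sq_def field_simps)
qed

definition prox_update :: "real \<Rightarrow> nat \<Rightarrow> 'a \<Rightarrow> 'a \<Rightarrow> 'a" where
  "prox_update \<alpha> i x u =
     prox (\<lambda>z. \<alpha> * f i z) (x + \<alpha> *\<^sub>R grad (f i) u - \<alpha> *\<^sub>R grad F u)"

text \<open>Here \<open>y\<close> is any minimizer whereas \<open>sigma_sq\<close> stays anchored at
  \<open>y0\<close>; the two are linked only by \<open>F y = F y0\<close>. Thus the infimum over
  \<open>y\<close> can be taken afterwards.\<close>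

lemma average_prox_update_le:
  assumes "0 < \<alpha>" and "\<alpha> * L < 1" and y: "y \<in> argmin_set F"
  shows "(\<Sum>i=1..n. (norm (prox_update \<alpha> i x u - y))\<^sup>2) / real n
    \<le> (norm (x - y))\<^sup>2 - 2 * \<alpha> * (1 - 2 * \<alpha> * L) * (F x - F y0) + 2 * \<alpha>\<^sup>2 * sigma_sq n f u y0"
proof -
  define e where "e i = grad (f i) u - grad F u" for i
  have F_y: "F y = F y0"
    using argmin_set_least[OF y] argmin_set_least[OF y0] by (intro antisym)
  have noise: "(\<Sum>i=1..n. (norm (grad (f i) x - e i))\<^sup>2)
      \<le> real n * (2 * (2 * L * (F x - F y0)) + 2 * sigma_sq n f u y0)"
  proof -
    \<comment> \<open>Measured relative to \<open>y0\<close>, the correction \<open>e i\<close> is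
      \<open>?b i\<close> minus its mean: that mean is \<open>grad F u\<close>, since
      \<open>grad F y0 = 0\<close>.\<close>
    let ?a = "\<lambda>i. grad (f i) x - grad (f i) y0" and ?b = "\<lambda>i. grad (f i) u - grad (f i) y0"
    have m: "(1 / real (card {1..n})) *\<^sub>R (\<Sum>i=1..n. ?b i) = grad F u"
      using grad_F_argmin by (simp add: sum_subtractf scaleR_diff_right grad_F)
    have "(\<Sum>i=1..n. (norm (grad (f i) x - e i))\<^sup>2) = (\<Sum>i=1..n. (norm (?a i - (?b i - grad F u)))\<^sup>2)"
      by (simp add: e_def)
    also have "\<dots> \<le> 2 * (\<Sum>i=1..n. (norm (?a i))\<^sup>2) + 2 * (\<Sum>i=1..n. (norm (?b i))\<^sup>2)"
      using sum_norm_sq_centered_le[of "{1..n}" ?a ?b] n_pos unfolding m by simp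
    also have "\<dots> = real n * (2 * sigma_sq n f x y0 + 2 * sigma_sq n f u y0)"
      using n_pos by (simp add: sigma_sq_def field_simps)
    also have "\<dots> \<le> real n * (2 * (2 * L * (F x - F y0)) + 2 * sigma_sq n f u y0)"
      using sigma_sq_le_gap[of x] by (intro mult_left_mono) auto
    finally show ?thesis .
  qed
  have "(\<Sum>i=1..n. (norm (prox_update \<alpha> i x u - y))\<^sup>2)
     \<le> (\<Sum>i=1..n. (norm (x - y))\<^sup>2 + 2 * \<alpha> * (f i y - f i x) + 2 * \<alpha> * inner (x - y) (e i)
           + \<alpha>\<^sup>2 * (norm (grad (f i) x - e i))\<^sup>2)"
  proof (rule sum_mono)
    fix i assume i: "i \<in> {1..n}"
    show "(norm (prox_update \<alpha> i x u - y))\<^sup>2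
       \<le> (norm (x - y))\<^sup>2 + 2 * \<alpha> * (f i y - f i x) + 2 * \<alpha> * inner (x - y) (e i)
           + \<alpha>\<^sup>2 * (norm (grad (f i) x - e i))\<^sup>2"
      using prox_step_estimate[OF smooth[OF i] convex[OF i] assms(1,2), of x "e i" y] L_pos
      by (simp add: prox_update_def e_def scaleR_diff_right algebra_simps)
  qed
  also have "\<dots> = real n * (norm (x - y))\<^sup>2 + 2 * \<alpha> * (real n * F y - real n * F x)
      + 2 * \<alpha> * inner (x - y) (\<Sum>i=1..n. e i) + \<alpha>\<^sup>2 * (\<Sum>i=1..n. (norm (grad (f i) x - e i))\<^sup>2)"
    by (simp add: sum.distrib sum_subtractf inner_sum_right flip: sum_distrib_left sum_f)
  also have "(\<Sum>i=1..n. e i) = 0"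
    using n_pos by (simp add: e_def sum_subtractf grad_F scaleR_left.sum[symmetric])
  also have "real n * (norm (x - y))\<^sup>2 + 2 * \<alpha> * (real n * F y - real n * F x)
      + 2 * \<alpha> * inner (x - y) 0 + \<alpha>\<^sup>2 * (\<Sum>i=1..n. (norm (grad (f i) x - e i))\<^sup>2)
    \<le> real n * (norm (x - y))\<^sup>2 + 2 * \<alpha> * (real n * F y - real n * F x)
      + 2 * \<alpha> * inner (x - y) 0
      + \<alpha>\<^sup>2 * (real n * (2 * (2 * L * (F x - F y0)) + 2 * sigma_sq n f u y0))"
    by (intro add_left_mono mult_left_mono noise) simp
  also have "\<dots> = real n * ((norm (x - y))\<^sup>2 - 2 * \<alpha> * (1 - 2 * \<alpha> * L) * (F x - F y0)
      + 2 * \<alpha>\<^sup>2 * sigma_sq n f u y0)"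
    unfolding F_y by (simp add: algebra_simps power2_eq_square)
  finally show ?thesis
    using n_pos by (simp add: pos_divide_le_eq mult.commute)
qed

text \<open>The left side is the mean Lyapunov value after one step from \<open>(x, u)\<close>, with
  index and coin averaged separately. The gap terms combine to
  \<open>- 2 * \<alpha> * \<kappa> * G\<close>, which quadratic growth turns into the first entry of
  \<open>q\<close>; the terms in \<open>sigma_sq n f u y0\<close> add up to the factor
  \<open>1 + 2 / M - p\<close>, the second entry.\<close>

lemma Lyapunov_decrease:
  assumes "\<mu> > 0" and "PL_condition \<mu> F" and "0 < p" and "M > 0"
    and "0 < \<alpha>" and \<alpha>: "\<alpha> * L * (2 + p * M) < 1"
    and q: "1 - \<alpha> * \<mu> * (1 - \<alpha> * L * (2 + p * M)) \<le> q" "1 + 2 / M - p \<le> q"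
  shows "(\<Sum>i=1..n. (infdist (prox_update \<alpha> i x u) (argmin_set F))\<^sup>2) / real n
      + \<alpha>\<^sup>2 * M * (p * sigma_sq n f x y0 + (1 - p) * sigma_sq n f u y0)
    \<le> q * ((infdist x (argmin_set F))\<^sup>2 + \<alpha>\<^sup>2 * M * sigma_sq n f u y0)"
proof -
  let ?S = "argmin_set F"
  define G D where "G = F x - F y0" and "D = (infdist x ?S)\<^sup>2"
  define \<kappa> where "\<kappa> = 1 - \<alpha> * L * (2 + p * M)"
  have "\<kappa> > 0" using \<alpha> by (simp add: \<kappa>_def)
  have "0 < \<alpha> * L * (p * M)"
    using assms L_pos by simp
  with \<alpha> have "\<alpha> * L * 2 < 1" by (simp only: distrib_left)
  then have "\<alpha> * L < 1"
    using \<open>0 < \<alpha>\<close> L_pos by simp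
  have "(\<Sum>i=1..n. (infdist (prox_update \<alpha> i x u) ?S)\<^sup>2) / real n
      \<le> D + (- 2 * \<alpha> * (1 - 2 * \<alpha> * L) * G + 2 * \<alpha>\<^sup>2 * sigma_sq n f u y0)"
    unfolding D_def
  proof (rule le_infdist_sq_plusI)
    fix y assume y: "y \<in> ?S"
    have "(\<Sum>i=1..n. (infdist (prox_update \<alpha> i x u) ?S)\<^sup>2) / real n
        \<le> (\<Sum>i=1..n. (norm (prox_update \<alpha> i x u - y))\<^sup>2) / real n"
      using infdist_le[OF y] infdist_nonneg
      by (intro divide_right_mono sum_mono power_mono) (auto simp: dist_norm)
    then show "(\<Sum>i=1..n. (infdist (prox_update \<alpha> i x u) ?S)\<^sup>2) / real n
        \<le> (dist x y)\<^sup>2 + (- 2 * \<alpha> * (1 - 2 * \<alpha> * L) * G + 2 * \<alpha>\<^sup>2 * sigma_sq n f u y0)"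
      using average_prox_update_le[OF \<open>0 < \<alpha>\<close> \<open>\<alpha> * L < 1\<close> y, of x u]
      by (simp add: dist_norm G_def)
  qed (use y0 in auto)
  moreover have "\<alpha>\<^sup>2 * M * p * sigma_sq n f x y0 \<le> \<alpha>\<^sup>2 * M * p * (2 * L * G)"
    using assms sigma_sq_le_gap[of x] unfolding G_def by (intro mult_left_mono) auto
  moreover have "\<alpha> * \<kappa> * (2 * (\<mu> / 2 * D)) \<le> \<alpha> * \<kappa> * (2 * G)"
    using PL_imp_quadratic_growth[OF L_smooth_F L_pos assms(1,2) y0, of x] \<open>0 < \<alpha>\<close> \<open>\<kappa> > 0\<close>
    unfolding G_def D_def by (intro mult_left_mono) auto
  moreover have "- 2 * \<alpha> * (1 - 2 * \<alpha> * L) * G + \<alpha>\<^sup>2 * M * p * (2 * L * G) = - (\<alpha> * \<kappa> * (2 * G))"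
    by (simp add: \<kappa>_def algebra_simps power2_eq_square)
  moreover have "2 * \<alpha>\<^sup>2 * sigma_sq n f u y0 + \<alpha>\<^sup>2 * M * ((1 - p) * sigma_sq n f u y0)
      = (1 + 2 / M - p) * (\<alpha>\<^sup>2 * M * sigma_sq n f u y0)"
    using \<open>M > 0\<close> by (simp add: field_simps)
  moreover have "(1 - \<alpha> * \<mu> * \<kappa>) * D \<le> q * D"
    using q(1) by (intro mult_right_mono) (auto simp: \<kappa>_def D_def)
  moreover have "(1 + 2 / M - p) * (\<alpha>\<^sup>2 * M * sigma_sq n f u y0) \<le> q * (\<alpha>\<^sup>2 * M * sigma_sq n f u y0)"
    using q(2) \<open>M > 0\<close> by (intro mult_right_mono mult_nonneg_nonneg sigma_sq_nonneg) auto
  ultimately show ?thesis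
    unfolding D_def[symmetric] by (simp add: algebra_simps)
qed

end

section \<open>Random variables of finite range\<close>

lemma (in prob_space) integrable_finite_range:
  fixes \<phi> :: "'b \<Rightarrow> real"
  assumes "Z \<in> M \<rightarrow>\<^sub>M count_space UNIV" and "finite B" and "AE \<omega> in M. Z \<omega> \<in> B"
  shows "integrable M (\<lambda>\<omega>. \<phi> (Z \<omega>))"
proof (rule integrable_const_bound)
  show "AE \<omega> in M. norm (\<phi> (Z \<omega>)) \<le> (\<Sum>b\<in>B. \<bar>\<phi> b\<bar>)"
    using assms(3)
  proof eventually_elim
    case (elim \<omega>)
    then show ?case
      using member_le_sum[of "Z \<omega>" B "\<lambda>b. \<bar>\<phi> b\<bar>"] assms(2) by simp
  qed
  show "(\<lambda>\<omega>. \<phi> (Z \<omega>)) \<in> borel_measurable M"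
    by (rule measurable_compose[OF assms(1)]) simp
qed

text \<open>Only the independence of the single variable \<open>Y\<close> from \<open>Z\<close> enters, so the estimate applies
  separately to the index and to the Bernoulli variable of a step, which may be dependent.\<close>

lemma (in prob_space) expectation_indep_finite_range:
  fixes g :: "'b \<Rightarrow> 'c::countable \<Rightarrow> real"
  assumes Z: "Z \<in> M \<rightarrow>\<^sub>M count_space UNIV" and B: "finite B" "AE \<omega> in M. Z \<omega> \<in> B"
    and Y: "Y \<in> M \<rightarrow>\<^sub>M count_space UNIV"
    and d: "distr M (count_space UNIV) Y = measure_pmf d" "finite (set_pmf d)"
    and indep: "\<And>b c. prob ((Y -` {c} \<inter> space M) \<inter> (Z -` {b} \<inter> space M))
      = prob (Y -` {c} \<inter> space M) * prob (Z -` {b} \<inter> space M)"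
  shows "expectation (\<lambda>\<omega>. g (Z \<omega>) (Y \<omega>)) = expectation (\<lambda>\<omega>. measure_pmf.expectation d (g (Z \<omega>)))"
proof -
  define ZB YC where "ZB b = Z -` {b} \<inter> space M" and "YC c = Y -` {c} \<inter> space M" for b c
  have [measurable]: "ZB b \<in> events" "YC c \<in> events" for b c
    using measurable_sets[OF Z] measurable_sets[OF Y] by (auto simp: ZB_def YC_def)
  let ?S = "set_pmf d"
  have "AE y in distr M (count_space UNIV) Y. y \<in> ?S"
    unfolding d(1) by (simp add: AE_measure_pmf)
  then have AE_Y: "AE \<omega> in M. Y \<omega> \<in> ?S"
    by (subst (asm) AE_distr_iff[OF Y]) auto
  have prob_Y: "prob (YC c) = pmf d c" for c
    using measure_distr[OF Y, of "{c}"] unfolding d(1) YC_def by (simp add: measure_pmf_single)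
  have meas: "(\<lambda>\<omega>. g (Z \<omega>) (Y \<omega>)) \<in> borel_measurable M"
    by (rule measurable_compose_countable[OF _ Y]) (rule measurable_compose[OF Z], simp)
  \<comment> \<open>Both expectations are expanded over the finitely many atoms of \<open>Z\<close>
    and \<open>Y\<close>, where independence factorizes each probability.\<close>
  have "expectation (\<lambda>\<omega>. g (Z \<omega>) (Y \<omega>))
      = expectation (\<lambda>\<omega>. \<Sum>b\<in>B. \<Sum>c\<in>?S. g b c * indicator (YC c \<inter> ZB b) \<omega>)"
  proof (rule integral_cong_AE[OF meas])
    show "AE \<omega> in M. g (Z \<omega>) (Y \<omega>) = (\<Sum>b\<in>B. \<Sum>c\<in>?S. g b c * indicator (YC c \<inter> ZB b) \<omega>)"
      using B(2) AE_Y AE_space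
    proof eventually_elim
      case (elim \<omega>)
      have "(\<Sum>b\<in>B. \<Sum>c\<in>?S. g b c * indicator (YC c \<inter> ZB b) \<omega>)
          = (\<Sum>b\<in>B. if b = Z \<omega> then \<Sum>c\<in>?S. if c = Y \<omega> then g b c else 0 else 0)"
        using elim(3) by (intro sum.cong refl) (auto simp: ZB_def YC_def indicator_def intro!: sum.cong)
      also have "\<dots> = g (Z \<omega>) (Y \<omega>)"
        using elim B(1) d(2) by simp
      finally show ?case ..
    qed
  qed measurable
  also have "\<dots> = (\<Sum>b\<in>B. \<Sum>c\<in>?S. g b c * prob (YC c \<inter> ZB b))"
    by (simp add: Bochner_Integration.integral_sum emeasure_eq_measure)
  also have "\<dots> = (\<Sum>b\<in>B. measure_pmf.expectation d (g b) * prob (ZB b))"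
  proof (rule sum.cong)
    fix b
    have "(\<Sum>c\<in>?S. g b c * prob (YC c \<inter> ZB b)) = (\<Sum>c\<in>?S. pmf d c * g b c) * prob (ZB b)"
      using indep by (simp add: prob_Y[symmetric] ZB_def YC_def sum_distrib_left sum_distrib_right ac_simps)
    then show "(\<Sum>c\<in>?S. g b c * prob (YC c \<inter> ZB b)) = measure_pmf.expectation d (g b) * prob (ZB b)"
      by (subst integral_measure_pmf[OF d(2)]) auto
  qed simp
  also have "\<dots> = expectation (\<lambda>\<omega>. \<Sum>b\<in>B. measure_pmf.expectation d (g b) * indicator (ZB b) \<omega>)"
    by (simp add: Bochner_Integration.integral_sum emeasure_eq_measure)
  also have "\<dots> = expectation (\<lambda>\<omega>. measure_pmf.expectation d (g (Z \<omega>)))"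
  proof (rule integral_cong_AE)
    show "(\<lambda>\<omega>. measure_pmf.expectation d (g (Z \<omega>))) \<in> borel_measurable M"
      by (rule measurable_compose[OF Z]) simp
    show "AE \<omega> in M. (\<Sum>b\<in>B. measure_pmf.expectation d (g b) * indicator (ZB b) \<omega>)
        = measure_pmf.expectation d (g (Z \<omega>))"
      using B(2) AE_space
    proof eventually_elim
      case (elim \<omega>)
      have "(\<Sum>b\<in>B. measure_pmf.expectation d (g b) * indicator (ZB b) \<omega>)
          = (\<Sum>b\<in>B. if b = Z \<omega> then measure_pmf.expectation d (g b) else 0)"
        using elim(2) by (intro sum.cong) (auto simp: ZB_def indicator_def)
      then show ?case using elim B(1) by simp
    qed
  qed measurable
  finally show ?thesis .
qed

section \<open>The L-SVRP process\<close>

locale lsvrp = convex_smooth_average f n L F y0 + prob_space P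
  for f :: "nat \<Rightarrow> 'a::{real_inner, complete_space} \<Rightarrow> real" and n L F y0 and P :: "'w measure" +
  fixes p \<alpha> :: real and \<iota> :: "nat \<Rightarrow> 'w \<Rightarrow> nat" and \<epsilon> :: "nat \<Rightarrow> 'w \<Rightarrow> bool"
    and x0 :: 'a and x u :: "nat \<Rightarrow> 'w \<Rightarrow> 'a"
  assumes p: "0 < p" "p \<le> 1"
    and sampling: "lsvrp_sampling P n p \<iota> \<epsilon>"
    and iterates: "lsvrp_iterates P n f \<alpha> \<iota> \<epsilon> x0 x u"
begin

lemma init: "\<omega> \<in> space P \<Longrightarrow> x 0 \<omega> = x0" "\<omega> \<in> space P \<Longrightarrow> u 0 \<omega> = x0"
  using iterates by (auto simp: lsvrp_iterates_def Let_def)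

lemma x_Suc: "\<omega> \<in> space P \<Longrightarrow> x (Suc k) \<omega> = prox_update \<alpha> (\<iota> k \<omega>) (x k \<omega>) (u k \<omega>)"
  using iterates unfolding lsvrp_iterates_def Let_def F_eq[symmetric] prox_update_def by blast

lemma u_Suc: "\<omega> \<in> space P \<Longrightarrow> u (Suc k) \<omega> = (if \<epsilon> k \<omega> then x k \<omega> else u k \<omega>)"
  using iterates by (auto simp: lsvrp_iterates_def Let_def)

lemma
  shows index_measurable: "\<iota> k \<in> P \<rightarrow>\<^sub>M count_space UNIV"
    and coin_measurable: "\<epsilon> k \<in> P \<rightarrow>\<^sub>M count_space UNIV"
    and index_distr: "distr P (count_space UNIV) (\<iota> k) = measure_pmf (pmf_of_set {1..n})"
    and coin_distr: "distr P (count_space UNIV) (\<epsilon> k) = measure_pmf (bernoulli_pmf p)"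
    and index_indep: "indep_set (generated_events P (\<iota> k)) (lsvrp_history P \<iota> \<epsilon> k)"
    and coin_indep: "indep_set (generated_events P (\<epsilon> k)) (lsvrp_history P \<iota> \<epsilon> k)"
  using sampling by (auto simp: lsvrp_sampling_def indep_vars_def)

lemma index_AE: "AE \<omega> in P. \<iota> k \<omega> \<in> {1..n}"
proof -
  have "AE i in distr P (count_space UNIV) (\<iota> k). i \<in> {1..n}"
    using n_pos unfolding index_distr by (simp add: AE_measure_pmf_iff)
  then show ?thesis
    by (subst (asm) AE_distr_iff[OF index_measurable]) auto
qed

section \<open>The state of the process and its measurability with respect to the past\<close>

definition state :: "nat \<Rightarrow> 'w \<Rightarrow> 'a \<times> 'a" where
  "state k \<omega> = (x k \<omega>, u k \<omega>)"

text \<open>The coin copies the old \<open>fst z\<close>, because \<open>u (Suc k)\<close> receives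
  \<open>x k\<close> and not \<open>x (Suc k)\<close>.\<close>

definition transition :: "nat \<Rightarrow> bool \<Rightarrow> 'a \<times> 'a \<Rightarrow> 'a \<times> 'a" where
  "transition i b z = (prox_update \<alpha> i (fst z) (snd z), if b then fst z else snd z)"

lemma state_Suc:
  "\<omega> \<in> space P \<Longrightarrow> state (Suc k) \<omega> = transition (\<iota> k \<omega>) (\<epsilon> k \<omega>) (state k \<omega>)"
  by (simp add: state_def transition_def x_Suc u_Suc)

text \<open>The family \<open>lsvrp_history\<close> recast as a measure, so that measurability with
  respect to the past can be expressed; only its space and its sets matter.\<close>

definition history :: "nat \<Rightarrow> 'w measure" where
  "history k = sigma (space P) (\<Union>j<k. generated_events P (\<iota> j) \<union> generated_events P (\<epsilon> j))"

lemma space_history: "space (history k) = space P"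
  by (simp add: history_def space_measure_of_conv)

lemma sets_history: "sets (history k) = lsvrp_history P \<iota> \<epsilon> k"
  unfolding history_def lsvrp_history_def
  by (rule sets_measure_of) (auto simp: generated_events_def)

lemma history_subalgebra: "j \<le> k \<Longrightarrow> subalgebra (history k) (history j)"
  unfolding subalgebra_def sets_history space_history lsvrp_history_def
  by (intro conjI refl sigma_sets_mono' UN_mono) auto

lemma generated_in_history:
  assumes "j < k"
  shows "\<iota> j \<in> history k \<rightarrow>\<^sub>M count_space UNIV" "\<epsilon> j \<in> history k \<rightarrow>\<^sub>M count_space UNIV"
proof -
  have sets: "E \<in> sets (history k)"
    if "E \<in> generated_events P (\<iota> j) \<union> generated_events P (\<epsilon> j)" for E
    unfolding sets_history lsvrp_history_def using that assms by (intro sigma_sets.Basic) blast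
  show "\<iota> j \<in> history k \<rightarrow>\<^sub>M count_space UNIV"
    by (rule measurableI, simp) (rule sets, auto simp: space_history generated_events_def)
  show "\<epsilon> j \<in> history k \<rightarrow>\<^sub>M count_space UNIV"
    by (rule measurableI, simp) (rule sets, auto simp: space_history generated_events_def)
qed

text \<open>The state depends on the discrete history only, so preimages of arbitrary sets are events.\<close>

lemma state_history_measurable: "state k \<in> history k \<rightarrow>\<^sub>M count_space UNIV"
proof (induction k)
  case 0
  have "state 0 \<in> history 0 \<rightarrow>\<^sub>M count_space UNIV
      \<longleftrightarrow> (\<lambda>_. (x0, x0)) \<in> history 0 \<rightarrow>\<^sub>M count_space UNIV"
    by (rule measurable_cong) (simp add: space_history state_def init)
  then show ?case by simp
next
  case (Suc k)
  have state: "state k \<in> history (Suc k) \<rightarrow>\<^sub>M count_space UNIV"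
    by (rule measurable_from_subalg[OF history_subalgebra Suc]) simp
  \<comment> \<open>Index and coin take countably many values, so they are first frozen and then
    released one after the other.\<close>
  have "(\<lambda>\<omega>. transition i b (state k \<omega>)) \<in> history (Suc k) \<rightarrow>\<^sub>M count_space UNIV" for i b
    by (rule measurable_compose[OF state]) simp
  then have "(\<lambda>\<omega>. transition i (\<epsilon> k \<omega>) (state k \<omega>)) \<in> history (Suc k) \<rightarrow>\<^sub>M count_space UNIV" for i
    by (rule measurable_compose_countable[OF _ generated_in_history(2)[OF lessI]])
  then have "(\<lambda>\<omega>. transition (\<iota> k \<omega>) (\<epsilon> k \<omega>) (state k \<omega>)) \<in> history (Suc k) \<rightarrow>\<^sub>M count_space UNIV"
    by (rule measurable_compose_countable[OF _ generated_in_history(1)[OF lessI]])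
  also have "?this \<longleftrightarrow> ?case"
    by (rule measurable_cong[symmetric]) (simp add: space_history state_Suc)
  finally show ?case .
qed

lemma state_measurable: "state k \<in> P \<rightarrow>\<^sub>M count_space UNIV"
proof -
  \<comment> \<open>Independence of the history includes that its members are events of
    \<open>P\<close>.\<close>
  have "subalgebra P (history k)"
    unfolding subalgebra_def sets_history space_history
    using indep_setD_ev2[OF index_indep] by simp
  then show ?thesis
    by (rule measurable_from_subalg[OF _ state_history_measurable])
qed

text \<open>Each step offers at most \<open>2 * n\<close> successors of a state, up to the null set
  on which the index leaves \<open>{1..n}\<close>. Hence every real function of the state is
  integrable and its expectation is a finite sum.\<close>

lemma state_finite_range: "\<exists>B. finite B \<and> (AE \<omega> in P. state k \<omega> \<in> B)"
proof (induction k)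
  case 0
  have "AE \<omega> in P. state 0 \<omega> \<in> {(x0, x0)}"
    by (rule AE_I2) (simp add: state_def init)
  then show ?case by blast
next
  case (Suc k)
  then obtain B where B: "finite B" "AE \<omega> in P. state k \<omega> \<in> B" by blast
  let ?B = "(\<lambda>(i, b, z). transition i b z) ` ({1..n} \<times> UNIV \<times> B)"
  have "AE \<omega> in P. state (Suc k) \<omega> \<in> ?B"
    using B(2) index_AE[of k] AE_space
  proof eventually_elim
    case (elim \<omega>)
    then show ?case
      by (intro image_eqI[of _ _ "(\<iota> k \<omega>, \<epsilon> k \<omega>, state k \<omega>)"]) (auto simp: state_Suc)
  qed
  moreover have "finite ?B" using B(1) by simp
  ultimately show ?case by blast
qed

lemma integrable_state:
  fixes \<phi> :: "'a \<times> 'a \<Rightarrow> real"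
  shows "integrable P (\<lambda>\<omega>. \<phi> (state k \<omega>))"
proof -
  obtain B where "finite B" "AE \<omega> in P. state k \<omega> \<in> B"
    using state_finite_range by blast
  then show ?thesis
    by (rule integrable_finite_range[OF state_measurable])
qed

lemma state_event_history: "state k -` A \<inter> space P \<in> lsvrp_history P \<iota> \<epsilon> k"
  using measurable_sets[OF state_history_measurable, of A k]
  by (simp add: space_history sets_history)

text \<open>This replaces conditioning on the past: the state is measurable with respect to the
  history, from which the index is independent.\<close>

lemma expectation_index:
  fixes g :: "'a \<times> 'a \<Rightarrow> nat \<Rightarrow> real"
  shows "expectation (\<lambda>\<omega>. g (state k \<omega>) (\<iota> k \<omega>))
    = expectation (\<lambda>\<omega>. (\<Sum>i=1..n. g (state k \<omega>) i) / real n)"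
proof -
  obtain B where B: "finite B" "AE \<omega> in P. state k \<omega> \<in> B"
    using state_finite_range by blast
  have "expectation (\<lambda>\<omega>. g (state k \<omega>) (\<iota> k \<omega>))
    = expectation (\<lambda>\<omega>. measure_pmf.expectation (pmf_of_set {1..n}) (g (state k \<omega>)))"
  proof (rule expectation_indep_finite_range[OF state_measurable B index_measurable index_distr])
    show "finite (set_pmf (pmf_of_set {1..n}))"
      using n_pos by simp
    show "prob ((\<iota> k -` {i} \<inter> space P) \<inter> (state k -` {b} \<inter> space P))
        = prob (\<iota> k -` {i} \<inter> space P) * prob (state k -` {b} \<inter> space P)" for b i
      by (rule indep_setD[OF index_indep]) (auto simp: generated_events_def state_event_history)
  qed
  then show ?thesis
    using n_pos by (simp add: integral_pmf_of_set)
qed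

lemma expectation_coin:
  fixes g :: "'a \<times> 'a \<Rightarrow> bool \<Rightarrow> real"
  shows "expectation (\<lambda>\<omega>. g (state k \<omega>) (\<epsilon> k \<omega>))
    = expectation (\<lambda>\<omega>. p * g (state k \<omega>) True + (1 - p) * g (state k \<omega>) False)"
proof -
  obtain B where B: "finite B" "AE \<omega> in P. state k \<omega> \<in> B"
    using state_finite_range by blast
  have "expectation (\<lambda>\<omega>. g (state k \<omega>) (\<epsilon> k \<omega>))
    = expectation (\<lambda>\<omega>. measure_pmf.expectation (bernoulli_pmf p) (g (state k \<omega>)))"
  proof (rule expectation_indep_finite_range[OF state_measurable B coin_measurable coin_distr])
    show "finite (set_pmf (bernoulli_pmf p))"
      by (rule finite_subset[OF subset_UNIV]) simp
    show "prob ((\<epsilon> k -` {c} \<inter> space P) \<inter> (state k -` {b} \<inter> space P))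
        = prob (\<epsilon> k -` {c} \<inter> space P) * prob (state k -` {b} \<inter> space P)" for b c
      by (rule indep_setD[OF coin_indep]) (auto simp: generated_events_def state_event_history)
  qed
  then show ?thesis
    using p by (simp add: mult.commute)
qed

section \<open>Contraction of the Lyapunov function in mean\<close>

definition Lyapunov :: "real \<Rightarrow> 'a \<times> 'a \<Rightarrow> real" where
  "Lyapunov M z = (infdist (fst z) (argmin_set F))\<^sup>2 + \<alpha>\<^sup>2 * M * sigma_sq n f (snd z) y0"

text \<open>The distance term of the next state involves only the new index and the
  \<open>sigma_sq\<close> term only the new coin. After splitting, each is averaged over its own
  variable; the two are then recombined under one expectation, where
  \<open>Lyapunov_decrease\<close> applies pointwise.\<close>

lemma expectation_Lyapunov_Suc:
  assumes "\<mu> > 0" and "PL_condition \<mu> F" and "M > 0"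
    and "0 < \<alpha>" and "\<alpha> * L * (2 + p * M) < 1"
    and "1 - \<alpha> * \<mu> * (1 - \<alpha> * L * (2 + p * M)) \<le> q" "1 + 2 / M - p \<le> q"
  shows "expectation (\<lambda>\<omega>. Lyapunov M (state (Suc k) \<omega>)) \<le> q * expectation (\<lambda>\<omega>. Lyapunov M (state k \<omega>))"
proof -
  let ?S = "argmin_set F"
  let ?\<sigma> = "\<lambda>v. sigma_sq n f v y0"
  have "expectation (\<lambda>\<omega>. Lyapunov M (state (Suc k) \<omega>))
     = expectation (\<lambda>\<omega>. (infdist (fst (state (Suc k) \<omega>)) ?S)\<^sup>2)
       + \<alpha>\<^sup>2 * M * expectation (\<lambda>\<omega>. ?\<sigma> (snd (state (Suc k) \<omega>)))"
    unfolding Lyapunov_def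
    using integrable_state[of "\<lambda>z. (infdist (fst z) ?S)\<^sup>2"] integrable_state[of "\<lambda>z. ?\<sigma> (snd z)"]
    by (subst Bochner_Integration.integral_add) auto
  also have "expectation (\<lambda>\<omega>. (infdist (fst (state (Suc k) \<omega>)) ?S)\<^sup>2)
     = expectation (\<lambda>\<omega>. (infdist (prox_update \<alpha> (\<iota> k \<omega>) (fst (state k \<omega>)) (snd (state k \<omega>))) ?S)\<^sup>2)"
    by (rule Bochner_Integration.integral_cong) (auto simp: state_Suc transition_def)
  also have "\<dots> = expectation (\<lambda>\<omega>.
      (\<Sum>i=1..n. (infdist (prox_update \<alpha> i (fst (state k \<omega>)) (snd (state k \<omega>))) ?S)\<^sup>2) / real n)"
    by (rule expectation_index[of "\<lambda>z i. (infdist (prox_update \<alpha> i (fst z) (snd z)) ?S)\<^sup>2"])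
  also have "expectation (\<lambda>\<omega>. ?\<sigma> (snd (state (Suc k) \<omega>)))
     = expectation (\<lambda>\<omega>. if \<epsilon> k \<omega> then ?\<sigma> (fst (state k \<omega>)) else ?\<sigma> (snd (state k \<omega>)))"
    by (rule Bochner_Integration.integral_cong) (auto simp: state_Suc transition_def)
  also have "\<dots> = expectation (\<lambda>\<omega>. p * ?\<sigma> (fst (state k \<omega>)) + (1 - p) * ?\<sigma> (snd (state k \<omega>)))"
    using expectation_coin[of "\<lambda>z b. if b then ?\<sigma> (fst z) else ?\<sigma> (snd z)"] by simp
  also have "expectation (\<lambda>\<omega>.
      (\<Sum>i=1..n. (infdist (prox_update \<alpha> i (fst (state k \<omega>)) (snd (state k \<omega>))) ?S)\<^sup>2) / real n)
      + \<alpha>\<^sup>2 * M * expectation (\<lambda>\<omega>. p * ?\<sigma> (fst (state k \<omega>)) + (1 - p) * ?\<sigma> (snd (state k \<omega>)))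
     = expectation (\<lambda>\<omega>.
      (\<Sum>i=1..n. (infdist (prox_update \<alpha> i (fst (state k \<omega>)) (snd (state k \<omega>))) ?S)\<^sup>2) / real n
      + \<alpha>\<^sup>2 * M * (p * ?\<sigma> (fst (state k \<omega>)) + (1 - p) * ?\<sigma> (snd (state k \<omega>))))"
    using integrable_state[of "\<lambda>z. (\<Sum>i=1..n. (infdist (prox_update \<alpha> i (fst z) (snd z)) ?S)\<^sup>2) / real n"]
      integrable_state[of "\<lambda>z. p * ?\<sigma> (fst z) + (1 - p) * ?\<sigma> (snd z)"]
    by (subst Bochner_Integration.integral_add) auto
  also have "\<dots> \<le> expectation (\<lambda>\<omega>. q * Lyapunov M (state k \<omega>))"
  proof (rule integral_mono)
    show "integrable P (\<lambda>\<omega>.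
      (\<Sum>i=1..n. (infdist (prox_update \<alpha> i (fst (state k \<omega>)) (snd (state k \<omega>))) ?S)\<^sup>2) / real n
      + \<alpha>\<^sup>2 * M * (p * ?\<sigma> (fst (state k \<omega>)) + (1 - p) * ?\<sigma> (snd (state k \<omega>))))"
      by (rule integrable_state[of "\<lambda>z.
        (\<Sum>i=1..n. (infdist (prox_update \<alpha> i (fst z) (snd z)) ?S)\<^sup>2) / real n
        + \<alpha>\<^sup>2 * M * (p * ?\<sigma> (fst z) + (1 - p) * ?\<sigma> (snd z))"])
    show "integrable P (\<lambda>\<omega>. q * Lyapunov M (state k \<omega>))"
      by (rule integrable_state[of "\<lambda>z. q * Lyapunov M z"])
  qed (unfold Lyapunov_def, rule Lyapunov_decrease[OF assms(1,2) p(1) assms(3-7)])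
  finally show ?thesis by simp
qed

lemma expectation_Lyapunov_le:
  assumes "\<mu> > 0" and "PL_condition \<mu> F" and "M > 0" and "q \<ge> 0"
    and "0 < \<alpha>" and "\<alpha> * L * (2 + p * M) < 1"
    and "1 - \<alpha> * \<mu> * (1 - \<alpha> * L * (2 + p * M)) \<le> q" "1 + 2 / M - p \<le> q"
  shows "expectation (\<lambda>\<omega>. Lyapunov M (state k \<omega>)) \<le> q ^ k * Lyapunov M (x0, x0)"
proof (induction k)
  case 0
  have "expectation (\<lambda>\<omega>. Lyapunov M (state 0 \<omega>)) = expectation (\<lambda>\<omega>. Lyapunov M (x0, x0))"
    by (rule Bochner_Integration.integral_cong) (auto simp: state_def init)
  then show ?case by (simp add: prob_space)
next
  case (Suc k)
  have "q * expectation (\<lambda>\<omega>. Lyapunov M (state k \<omega>)) \<le> q * (q ^ k * Lyapunov M (x0, x0))"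
    using Suc \<open>q \<ge> 0\<close> by (rule mult_left_mono)
  with expectation_Lyapunov_Suc[OF assms(1-3,5-8), of k] show ?case by simp
qed

end

section \<open>The linear rates for distances and function values\<close>

theorem corollary4p13:
  fixes f :: "nat \<Rightarrow> 'a::{real_inner, complete_space, second_countable_topology} \<Rightarrow> real"
    and F :: "'a \<Rightarrow> real"
    and P :: "'w measure"
    and \<iota> :: "nat \<Rightarrow> 'w \<Rightarrow> nat"
    and \<epsilon> :: "nat \<Rightarrow> 'w \<Rightarrow> bool"
    and x u :: "nat \<Rightarrow> 'w \<Rightarrow> 'a"
    and x0 y0 :: 'a
    and n :: nat
    and L \<mu> p \<alpha> M q :: real
  assumes "n \<ge> 1"
    and "F = (\<lambda>z. 1 / real n * (\<Sum>i=1..n. f i z))"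
    and "argmin_set F \<noteq> {}"
    and "L > 0"
    and "\<And>i. i \<in> {1..n} \<Longrightarrow> convex_on UNIV (f i)"
    and "\<And>i. i \<in> {1..n} \<Longrightarrow> L_smooth L (f i)"
    and "\<mu> > 0"
    and "PL_condition \<mu> F"
    and "prob_space P"
    and "0 < p" and "p \<le> 1"
    and "lsvrp_sampling P n p \<iota> \<epsilon>"
    and "lsvrp_iterates P n f \<alpha> \<iota> \<epsilon> x0 x u"
    and "M > 2 / p"
    and "0 < \<alpha>" and "\<alpha> < 1 / (L * (2 + p * M))"
    and "q = max (1 - \<alpha> * \<mu> * (1 - \<alpha> * L * (2 + p * M))) (1 + 2 / M - p)"
    and "y0 \<in> argmin_set F" and "norm (x0 - y0) = infdist x0 (argmin_set F)"
  shows "0 < q \<and> q < 1 \<and>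
    (\<forall>k.
      integrable P (\<lambda>\<omega>. (infdist (x k \<omega>) (argmin_set F))\<^sup>2) \<and>
      prob_space.expectation P (\<lambda>\<omega>. (infdist (x k \<omega>) (argmin_set F))\<^sup>2)
        \<le> q ^ k * ((infdist x0 (argmin_set F))\<^sup>2
             + \<alpha>\<^sup>2 * M * prob_space.expectation P (\<lambda>\<omega>. sigma_sq n f (u 0 \<omega>) y0)) \<and>
      integrable P (\<lambda>\<omega>. F (x k \<omega>) - (INF z. F z)) \<and>
      prob_space.expectation P (\<lambda>\<omega>. F (x k \<omega>) - (INF z. F z))
        \<le> q ^ k * L / 2 * ((infdist x0 (argmin_set F))\<^sup>2
             + \<alpha>\<^sup>2 * M * prob_space.expectation P (\<lambda>\<omega>. sigma_sq n f (u 0 \<omega>) y0)))"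
proof -
  interpret prob_space P by fact
  interpret convex_smooth_average f n L F y0
    using assms by unfold_locales auto
  interpret lsvrp f n L F y0 P p \<alpha> \<iota> \<epsilon> x0 x u
    using assms by unfold_locales auto
  let ?S = "argmin_set F"
  have "M > 0"
    using assms(10,14) by (meson divide_pos_pos less_trans zero_less_numeral)
  then have "2 + p * M > 0"
    using p by (simp add: add_pos_pos)
  then have \<alpha>: "\<alpha> * L * (2 + p * M) < 1"
    using assms(16) L_pos by (simp add: pos_less_divide_eq mult.assoc)
  have "0 < 2 / M" "2 / M < p"
    using \<open>M > 0\<close> p assms(14) by (auto simp: field_simps)
  moreover have "0 < \<alpha> * \<mu> * (1 - \<alpha> * L * (2 + p * M))"
    using assms(7,15) \<alpha> by simp
  \<comment> \<open>Positivity comes from the second entry of the maximum, as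
    \<open>p \<le> 1\<close> and \<open>0 < 2 / M\<close>; both entries are below 1 by the
    conditions on \<open>\<alpha>\<close> and \<open>M\<close>.\<close>
  ultimately have q: "0 < q" "q < 1"
    using p(2) unfolding assms(17) less_max_iff_disj max_less_iff_conj by linarith+
  have Lyapunov_le: "expectation (\<lambda>\<omega>. Lyapunov M (state k \<omega>)) \<le> q ^ k * Lyapunov M (x0, x0)" for k
    using expectation_Lyapunov_le[OF assms(7,8) \<open>M > 0\<close> _ assms(15) \<alpha>, of q k] q assms(17) by simp
  have "expectation (\<lambda>\<omega>. sigma_sq n f (u 0 \<omega>) y0) = expectation (\<lambda>\<omega>. sigma_sq n f x0 y0)"
    by (rule Bochner_Integration.integral_cong) (auto simp: init)
  then have Lyapunov_0: "Lyapunov M (x0, x0) =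
      (infdist x0 ?S)\<^sup>2 + \<alpha>\<^sup>2 * M * expectation (\<lambda>\<omega>. sigma_sq n f (u 0 \<omega>) y0)"
    by (simp add: Lyapunov_def prob_space)
  have dist_integrable: "integrable P (\<lambda>\<omega>. (infdist (x k \<omega>) ?S)\<^sup>2)" for k
    using integrable_state[of "\<lambda>z. (infdist (fst z) ?S)\<^sup>2" k] by (simp add: state_def)
  have gap_integrable: "integrable P (\<lambda>\<omega>. F (x k \<omega>) - (INF z. F z))" for k
    using integrable_state[of "\<lambda>z. F (fst z) - (INF z. F z)" k] by (simp add: state_def)
  have dist_le: "expectation (\<lambda>\<omega>. (infdist (x k \<omega>) ?S)\<^sup>2) \<le> q ^ k * Lyapunov M (x0, x0)" for k
  proof -
    have "expectation (\<lambda>\<omega>. (infdist (x k \<omega>) ?S)\<^sup>2) \<le> expectation (\<lambda>\<omega>. Lyapunov M (state k \<omega>))"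
      using \<open>M > 0\<close>
      by (intro integral_mono dist_integrable integrable_state)
        (simp add: Lyapunov_def state_def sigma_sq_nonneg)
    with Lyapunov_le[of k] show ?thesis by linarith
  qed
  have gap_le: "expectation (\<lambda>\<omega>. F (x k \<omega>) - (INF z. F z)) \<le> q ^ k * L / 2 * Lyapunov M (x0, x0)" for k
  proof -
    have "expectation (\<lambda>\<omega>. F (x k \<omega>) - (INF z. F z)) \<le> expectation (\<lambda>\<omega>. L / 2 * (infdist (x k \<omega>) ?S)\<^sup>2)"
      using L_smooth_gap_le_infdist[OF L_smooth_F L_pos y0]
      by (intro integral_mono gap_integrable integrable_mult_right dist_integrable)
        (simp add: argmin_set_INF[OF y0])
    also have "\<dots> = L / 2 * expectation (\<lambda>\<omega>. (infdist (x k \<omega>) ?S)\<^sup>2)" by simp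
    also have "\<dots> \<le> L / 2 * (q ^ k * Lyapunov M (x0, x0))"
      using L_pos dist_le by (intro mult_left_mono) auto
    finally show ?thesis by (simp add: ac_simps)
  qed
  show ?thesis
    using q dist_integrable gap_integrable dist_le gap_le unfolding Lyapunov_0 by blast
qed

end
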